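(* Let $W$ be a random variable taking values in $\mathbb{N}=\{1,2,\ldots\}$ with probability generating function $\rho(s)=\mathbb{E}[s^W]$, and let $F_\rho$ and $\alpha^*_\rho$ be as defined in the context. Then $F_\rho(\alpha)=0$ for $0\le\alpha\le\alpha^*_\rho$ but $F_\rho(\alpha)>0$ for $\alpha>\alpha^*_\rho$, and $F_\rho$ is continuous and nondecreasing as a function of $\alpha\ge 0$. Moreover: (i) $\alpha^*_\rho\in[0,1]$; and $\alpha^*_\rho<1$ if $\mathbb{E}[W]<\infty$. (ii) $\alpha^*_\rho=0$ if and only if $\mathbb{P}[W=1]>0$. (iii) If $\mathbb{P}[W=2]=1$, then $\alpha^*_\rho=1/2$. (iv) Suppose that $\tilde W$ is another $\mathbb{N}$-valued random variable, with $\tilde\rho(s)=\mathbb{E}[s^{\tilde W}]$, such that $\tilde\rho(s)\le\rho(s)$ for all $s\in[0,1]$ (which is the case, for example, if $\tilde W$ stochastically dominates $W$). Then $\alpha^*_{\tilde\rho}\ge\alpha^*_\rho$. In particular, if $\mathbb{P}[W\ge 2]=1$ and $\mathbb{E}[W]<\infty$, then $\alpha^*_\rho\in[1/2,1)$.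
   Context: Convention: $0^0:=1$. For the probability generating function $\rho$ of an $\mathbb{N}$-valued random variable and $\alpha\ge 0$, define $$F_\rho(\alpha):=\log\sup_{\gamma\in[0,1/2]}\left(\frac{(1+\rho(1-2\gamma))^\alpha}{2\gamma^\gamma(1-\gamma)^{1-\gamma}}\right),\qquad \alpha^*_\rho:=\inf\{\alpha\ge 0: F_\rho(\alpha)>0\}.$$ *)

theory Defs
  imports "HOL-Probability.Probability"
begin

text \<open>Real powers with the convention \<open>0\<^sup>0 = 1\<close>; the library has \<open>0 powr 0 = 0\<close>.\<close>

definition rpow :: "real \<Rightarrow> real \<Rightarrow> real" where
  "rpow x y = (if x = 0 \<and> y = 0 then 1 else x powr y)"

definition pgf :: "'a measure \<Rightarrow> ('a \<Rightarrow> nat) \<Rightarrow> real \<Rightarrow> real" where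
  "pgf M W s = (\<integral>\<omega>. s ^ W \<omega> \<partial>M)"

text \<open>For a probability generating function \<open>\<rho>\<close> and \<open>\<alpha> \<ge> 0\<close> the numerator is at most
  \<open>2 powr \<alpha>\<close> and the denominator at least \<open>1\<close>, so the real supremum is taken over a bounded set.\<close>

definition F :: "(real \<Rightarrow> real) \<Rightarrow> real \<Rightarrow> real" where
  "F \<rho> \<alpha> = ln (SUP \<gamma>\<in>{0..1/2}.
     rpow (1 + \<rho> (1 - 2 * \<gamma>)) \<alpha> / (2 * rpow \<gamma> \<gamma> * rpow (1 - \<gamma>) (1 - \<gamma>)))"

text \<open>For a probability generating function the set is nonempty: the term \<open>\<gamma> = 0\<close> gives
  \<open>F \<rho> \<alpha> \<ge> (\<alpha> - 1) * ln 2\<close>.\<close>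

definition alpha_star :: "(real \<Rightarrow> real) \<Rightarrow> real" where
  "alpha_star \<rho> = Inf {\<alpha>. \<alpha> \<ge> 0 \<and> F \<rho> \<alpha> > 0}"

text \<open>\<open>V\<close> on \<open>N\<close> stochastically dominates \<open>W\<close> on \<open>M\<close>; the two variables need not share a
  probability space.\<close>

definition stoch_dominates ::
  "'b measure \<Rightarrow> ('b \<Rightarrow> nat) \<Rightarrow> 'a measure \<Rightarrow> ('a \<Rightarrow> nat) \<Rightarrow> bool" where
  "stoch_dominates N V M W \<longleftrightarrow>
     (\<forall>k. \<P>(\<omega> in M. W \<omega> \<ge> k) \<le> \<P>(\<omega> in N. V \<omega> \<ge> k))"

end

theory Submission
  imports Defs "HOL-Real_Asymp.Real_Asymp"
begin

text \<open>
  Substitute \<open>x = 1 - 2\<gamma>\<close>. Then \<open>F \<rho> \<alpha>\<close> is the supremum over \<open>x \<in> [0, 1]\<close> of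
  \<open>\<alpha> ln (1 + \<rho> x) - D x\<close>, where \<open>D x = ((1 + x) ln (1 + x) + (1 - x) ln (1 - x)) / 2\<close> is the
  relative entropy of Bernoulli(\<open>(1 + x) / 2\<close>) with respect to Bernoulli(\<open>1 / 2\<close>).
  At \<open>x = 0\<close> the objective vanishes, and it is nondecreasing and \<open>ln 2\<close>-Lipschitz in \<open>\<alpha>\<close>, which
  gives everything up to \<open>\<alpha>\<^sup>* \<in> [0, 1]\<close>. The rest is local: near \<open>x = 0\<close> one has
  \<open>D x = x\<^sup>2 / 2 + o(x\<^sup>2)\<close>, so a linear term of \<open>\<rho>\<close> forces \<open>F > 0\<close> for every \<open>\<alpha> > 0\<close>, and \<open>\<rho> x = x\<^sup>2\<close>
  forces it exactly for \<open>\<alpha> > 1 / 2\<close> because \<open>D x \<ge> x\<^sup>2 / 2 \<ge> ln (1 + x\<^sup>2) / 2\<close>;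
  near \<open>x = 1\<close> the infinite slope of \<open>D\<close> beats the finite slope of \<open>\<rho>\<close> when \<open>W\<close> has a finite mean.
\<close>

section \<open>The entropy function and the change of variable\<close>

definition D :: "real \<Rightarrow> real" where
  "D x = ((1 + x) * ln (1 + x) + (1 - x) * ln (1 - x)) / 2"

lemma D_0 [simp]: "D 0 = 0"
  by (simp add: D_def)

lemma D_1 [simp]: "D 1 = ln 2"
  by (simp add: D_def)

text \<open>For x < 1, differentiate \<open>D x - x^2 / 2\<close>: the first derivative is artanh x
  - x, whose own derivative 1 / (1 - x^2) - 1 is nonnegative, and both functions vanish at 0. The
  endpoint x = 1, where the slope is infinite, follows from ln 2 >= 2/3.\<close>

lemma D_ge_half_square:
  assumes "0 \<le> x" "x \<le> 1"
  shows "x\<^sup>2 / 2 \<le> D x"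
proof (cases "x = 1")
  case True
  then show ?thesis
    using ln2_ge_two_thirds by simp
next
  case False
  then have "x < 1" using assms by simp
  let ?g = "\<lambda>x. D x - x\<^sup>2 / 2"
  let ?h = "\<lambda>x. (ln (1 + x) - ln (1 - x)) / 2 - x :: real"
  have h: "0 \<le> ?h y" if "0 \<le> y" "y < 1" for y
  proof -
    have "?h 0 \<le> ?h y"
    proof (rule DERIV_nonneg_imp_nondecreasing[OF that(1)])
      fix z assume z: "0 \<le> z" "z \<le> y"
      then have z1: "z < 1" "z * z < 1"
        using that mult_strict_mono'[of z 1 z 1] by auto
      have "(?h has_real_derivative (1 / (1 + z) + 1 / (1 - z)) / 2 - 1) (at z)"
        using z z1 by (auto intro!: derivative_eq_intros simp: field_simps)
      moreover have "0 \<le> (1 / (1 + z) + 1 / (1 - z)) / 2 - 1"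
      proof -
        have "1 / (1 + z) + 1 / (1 - z) = 2 / (1 - z * z)"
          using z z1 by (simp add: divide_simps) (simp add: algebra_simps)
        also have "\<dots> \<ge> 2"
          using z1 z by (simp add: le_divide_eq)
        finally show ?thesis by simp
      qed
      ultimately show "\<exists>d. (?h has_real_derivative d) (at z) \<and> 0 \<le> d" by blast
    qed
    then show ?thesis by simp
  qed
  have "?g 0 \<le> ?g x"
  proof (rule DERIV_nonneg_imp_nondecreasing[OF assms(1)])
    fix z assume z: "0 \<le> z" "z \<le> x"
    then have z1: "1 + z > 0" "1 - z > 0"
      using \<open>x < 1\<close> by auto
    have "((\<lambda>x. (1 + x) * ln (1 + x)) has_real_derivative ln (1 + z) + 1) (at z)"
      "((\<lambda>x. (1 - x) * ln (1 - x)) has_real_derivative - ln (1 - z) - 1) (at z)"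
      using z1 by (auto intro!: derivative_eq_intros)
    note sum = DERIV_cdivide[OF DERIV_add[OF this], of 2]
    have "((\<lambda>x. x\<^sup>2 / 2) has_real_derivative z) (at z)"
      by (auto intro!: derivative_eq_intros)
    then have "(?g has_real_derivative ?h z) (at z)"
      using DERIV_diff[OF sum] unfolding D_def by simp
    then show "\<exists>d. (?g has_real_derivative d) (at z) \<and> 0 \<le> d"
      using h[of z] z \<open>x < 1\<close> by auto
  qed
  then show ?thesis by simp
qed

lemma D_nonneg: "0 \<le> x \<Longrightarrow> x \<le> 1 \<Longrightarrow> 0 \<le> D x"
  using D_ge_half_square[of x] zero_le_power2[of x] by linarith

text \<open>With x = 1 - 2\<gamma> one has 1 + x = 2 (1 - \<gamma>) and 1 - x = 2\<gamma>, so the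
  denominator is exp (D x). At \<gamma> = 0 the convention in \<open>rpow\<close> agrees with exp (0
  * ln 0) = 1.\<close>

lemma F_summand_eq:
  assumes "0 \<le> \<gamma>" "\<gamma> \<le> 1/2" "0 \<le> \<rho> (1 - 2 * \<gamma>)"
  shows "rpow (1 + \<rho> (1 - 2 * \<gamma>)) \<alpha> / (2 * rpow \<gamma> \<gamma> * rpow (1 - \<gamma>) (1 - \<gamma>))
    = exp (\<alpha> * ln (1 + \<rho> (1 - 2 * \<gamma>)) - D (1 - 2 * \<gamma>))"
proof -
  have rpow: "rpow y y = exp (y * ln y)" if "0 \<le> y" for y
    using that by (auto simp: rpow_def powr_def)
  have "exp (D (1 - 2 * \<gamma>)) = exp (ln 2 + \<gamma> * ln \<gamma> + (1 - \<gamma>) * ln (1 - \<gamma>))"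
  proof (cases "\<gamma> = 0")
    case False
    have "1 + (1 - 2 * \<gamma>) = 2 * (1 - \<gamma>)" "1 - (1 - 2 * \<gamma>) = 2 * \<gamma>" by simp_all
    moreover have "ln (2 * (1 - \<gamma>)) = ln 2 + ln (1 - \<gamma>)" "ln (2 * \<gamma>) = ln 2 + ln \<gamma>"
      using False assms by - (rule ln_mult_pos; simp)+
    ultimately show ?thesis
      unfolding D_def by (simp only:) (simp add: field_simps)
  qed simp
  then have "exp (D (1 - 2 * \<gamma>)) = 2 * rpow \<gamma> \<gamma> * rpow (1 - \<gamma>) (1 - \<gamma>)"
    using assms by (simp add: rpow exp_add)
  moreover have "rpow (1 + \<rho> (1 - 2 * \<gamma>)) \<alpha> = exp (\<alpha> * ln (1 + \<rho> (1 - 2 * \<gamma>)))"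
    using assms by (simp add: rpow_def powr_def)
  ultimately show ?thesis
    by (simp add: exp_diff)
qed

section \<open>Regularity of \<open>F\<close> in \<alpha>\<close>

text \<open>Isolates the analytic input from a probability generating function. The value 0 at 0
  reflects W >= 1 and makes the objective vanish there; the value 1 at 1 bounds the threshold by
  1.\<close>

locale unit_interval_map =
  fixes \<rho> :: "real \<Rightarrow> real"
  assumes at_0: "\<rho> 0 = 0"
    and at_1: "\<rho> 1 = 1"
    and nonneg: "0 \<le> x \<Longrightarrow> x \<le> 1 \<Longrightarrow> 0 \<le> \<rho> x"
    and le_1: "0 \<le> x \<Longrightarrow> x \<le> 1 \<Longrightarrow> \<rho> x \<le> 1"
begin

definition obj :: "real \<Rightarrow> real \<Rightarrow> real" where
  "obj \<alpha> x = \<alpha> * ln (1 + \<rho> x) - D x"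

lemma ln_nonneg: "0 \<le> x \<Longrightarrow> x \<le> 1 \<Longrightarrow> 0 \<le> ln (1 + \<rho> x)"
  using nonneg by simp

lemma ln_le: "0 \<le> x \<Longrightarrow> x \<le> 1 \<Longrightarrow> ln (1 + \<rho> x) \<le> ln 2"
  using nonneg[of x] le_1[of x] by simp

lemma F_eq: "F \<rho> \<alpha> = ln (SUP x\<in>{0..1}. exp (obj \<alpha> x))"
proof -
  have "{0..1} = (\<lambda>\<gamma>. 1 - 2 * \<gamma>) ` {0..1/2 :: real}"
    by (auto simp: image_iff intro!: bexI[of _ "(1 - x) / 2" for x] simp: field_simps)
  then have "(\<lambda>x. exp (obj \<alpha> x)) ` {0..1} = (\<lambda>\<gamma>. exp (obj \<alpha> (1 - 2 * \<gamma>))) ` {0..1/2}"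
    by (simp add: image_image)
  also have "\<dots> = (\<lambda>\<gamma>. rpow (1 + \<rho> (1 - 2 * \<gamma>)) \<alpha>
      / (2 * rpow \<gamma> \<gamma> * rpow (1 - \<gamma>) (1 - \<gamma>))) ` {0..1/2}"
    unfolding obj_def by (intro image_cong refl F_summand_eq[symmetric]) (auto intro: nonneg)
  finally show ?thesis
    by (simp add: F_def)
qed

lemma obj_0 [simp]: "obj \<alpha> 0 = 0"
  by (simp add: obj_def at_0)

lemma obj_le:
  assumes "0 \<le> \<alpha>" "0 \<le> x" "x \<le> 1"
  shows "obj \<alpha> x \<le> \<alpha> * ln 2"
  unfolding obj_def using mult_left_mono[OF ln_le assms(1)] D_nonneg assms by fastforce

lemma bdd_above_exp_obj:
  assumes "0 \<le> \<alpha>"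
  shows "bdd_above ((\<lambda>x. exp (obj \<alpha> x)) ` {0..1})"
  by (rule bdd_aboveI[of _ "exp (\<alpha> * ln 2)"]) (auto intro: obj_le assms)

lemma F_ge:
  assumes "0 \<le> \<alpha>" "0 \<le> x" "x \<le> 1"
  shows "obj \<alpha> x \<le> F \<rho> \<alpha>"
proof -
  have "exp (obj \<alpha> x) \<le> (SUP x\<in>{0..1}. exp (obj \<alpha> x))"
    using assms by (intro cSUP_upper bdd_above_exp_obj) auto
  then show ?thesis
    unfolding F_eq by (metis exp_gt_zero ln_exp ln_mono)
qed

lemma F_le:
  assumes "0 \<le> \<alpha>" "\<And>x. 0 \<le> x \<Longrightarrow> x \<le> 1 \<Longrightarrow> obj \<alpha> x \<le> c"
  shows "F \<rho> \<alpha> \<le> c"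
proof -
  have "(SUP x\<in>{0..1}. exp (obj \<alpha> x)) \<le> exp c"
    using assms by (intro cSUP_least) auto
  \<comment> \<open>The value 1 at x = 0 shows that the supremum is positive, as monotonicity of
    \<open>ln\<close> requires.\<close>
  moreover have "exp (obj \<alpha> 0) \<le> (SUP x\<in>{0..1}. exp (obj \<alpha> x))"
    using assms by (intro cSUP_upper bdd_above_exp_obj) auto
  ultimately have "ln (SUP x\<in>{0..1}. exp (obj \<alpha> x)) \<le> ln (exp c)"
    by (intro ln_mono) auto
  then show ?thesis
    by (simp add: F_eq)
qed

lemma F_nonneg: "0 \<le> \<alpha> \<Longrightarrow> 0 \<le> F \<rho> \<alpha>"
  using F_ge[of \<alpha> 0] by simp

lemma F_zero: "F \<rho> 0 = 0"
  by (rule antisym[OF F_le F_nonneg]) (auto simp: obj_def D_nonneg)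

lemma F_mono:
  assumes "0 \<le> \<alpha>" "\<alpha> \<le> \<beta>"
  shows "F \<rho> \<alpha> \<le> F \<rho> \<beta>"
proof (rule F_le[OF assms(1)])
  fix x :: real assume x: "0 \<le> x" "x \<le> 1"
  have "obj \<alpha> x \<le> obj \<beta> x"
    unfolding obj_def using mult_right_mono[OF assms(2) ln_nonneg[OF x]] by simp
  then show "obj \<alpha> x \<le> F \<rho> \<beta>"
    using F_ge[of \<beta> x] assms x by simp
qed

text \<open>Each objective is affine in \<alpha> with slope ln (1 + \<rho> x) <= ln 2, and a uniform
  slope bound passes to the supremum.\<close>

lemma F_lipschitz:
  assumes "0 \<le> \<alpha>" "\<alpha> \<le> \<beta>"
  shows "F \<rho> \<beta> \<le> F \<rho> \<alpha> + (\<beta> - \<alpha>) * ln 2"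
proof (rule F_le)
  show "0 \<le> \<beta>" using assms by simp
  fix x :: real assume x: "0 \<le> x" "x \<le> 1"
  have "(\<beta> - \<alpha>) * ln (1 + \<rho> x) \<le> (\<beta> - \<alpha>) * ln 2"
    using assms ln_le[OF x] by (intro mult_left_mono) auto
  then have "obj \<beta> x \<le> obj \<alpha> x + (\<beta> - \<alpha>) * ln 2"
    unfolding obj_def by (simp add: algebra_simps)
  then show "obj \<beta> x \<le> F \<rho> \<alpha> + (\<beta> - \<alpha>) * ln 2"
    using F_ge[of \<alpha> x] assms x by simp
qed

lemma continuous_on_F: "continuous_on {0..} (F \<rho>)"
proof -
  have "(ln 2)-lipschitz_on {0..} (F \<rho>)"
  proof (rule lipschitz_on_leI)
    fix \<alpha> \<beta> :: real assume "\<alpha> \<in> {0..}" "\<beta> \<in> {0..}" "\<alpha> \<le> \<beta>"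
    then show "dist (F \<rho> \<alpha>) (F \<rho> \<beta>) \<le> ln 2 * dist \<alpha> \<beta>"
      using F_lipschitz[of \<alpha> \<beta>] F_mono[of \<alpha> \<beta>] by (simp add: dist_real_def abs_if algebra_simps)
  qed simp
  then show ?thesis
    by (rule lipschitz_on_continuous_on)
qed

section \<open>The threshold \<open>alpha_star\<close>\<close>

text \<open>The point x = 1 is a witness: both logarithmic terms there are multiples of ln
  2.\<close>

lemma F_pos_if_gt_1:
  assumes "1 < \<alpha>"
  shows "0 < F \<rho> \<alpha>"
proof -
  have "0 < (\<alpha> - 1) * ln 2"
    using assms by simp
  also have "\<dots> = obj \<alpha> 1"
    by (simp add: obj_def at_1 algebra_simps)
  also have "\<dots> \<le> F \<rho> \<alpha>"
    using assms by (intro F_ge) auto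
  finally show ?thesis .
qed

lemma positive_set_nonempty: "{\<alpha>. \<alpha> \<ge> 0 \<and> F \<rho> \<alpha> > 0} \<noteq> {}"
  using F_pos_if_gt_1[of 2] by (auto intro!: exI[of _ 2])

lemma alpha_star_le:
  assumes "0 \<le> \<alpha>" "0 < F \<rho> \<alpha>"
  shows "alpha_star \<rho> \<le> \<alpha>"
  unfolding alpha_star_def using assms by (intro cInf_lower bdd_belowI[of _ 0]) auto

lemma alpha_star_ge:
  assumes "\<And>\<alpha>. 0 \<le> \<alpha> \<Longrightarrow> 0 < F \<rho> \<alpha> \<Longrightarrow> c \<le> \<alpha>"
  shows "c \<le> alpha_star \<rho>"
  unfolding alpha_star_def using assms by (intro cInf_greatest positive_set_nonempty) auto

lemma alpha_star_nonneg: "0 \<le> alpha_star \<rho>"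
  by (rule alpha_star_ge)

lemma alpha_star_le_if_pos_above:
  assumes "0 \<le> c" "\<And>\<alpha>. c < \<alpha> \<Longrightarrow> 0 < F \<rho> \<alpha>"
  shows "alpha_star \<rho> \<le> c"
  by (rule dense_ge) (use assms alpha_star_le in force)

lemma alpha_star_le_1: "alpha_star \<rho> \<le> 1"
  by (rule alpha_star_le_if_pos_above) (auto intro: F_pos_if_gt_1)

lemma F_pos_above:
  assumes "alpha_star \<rho> < \<alpha>"
  shows "0 < F \<rho> \<alpha>"
proof -
  obtain \<beta> where "0 \<le> \<beta>" "0 < F \<rho> \<beta>" "\<beta> < \<alpha>"
    using cInf_lessD[OF positive_set_nonempty assms[unfolded alpha_star_def]] by auto
  then show ?thesis
    using F_mono[of \<beta> \<alpha>] by simp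
qed

text \<open>By the Lipschitz bound, positivity of \<open>F\<close> persists slightly to the left of
  \<alpha>, so the infimum is not attained at a positive point.\<close>

lemma alpha_star_less:
  assumes "0 < \<alpha>" "0 < F \<rho> \<alpha>"
  shows "alpha_star \<rho> < \<alpha>"
proof -
  \<comment> \<open>Moving left by at most half of \<open>F \<rho> \<alpha>\<close> loses at most
    half of that value, since ln 2 < 1; the maximum keeps \<beta> nonnegative.\<close>
  define \<beta> where "\<beta> = max 0 (\<alpha> - F \<rho> \<alpha> / 2)"
  have \<beta>: "0 \<le> \<beta>" "\<beta> < \<alpha>" "\<alpha> - \<beta> \<le> F \<rho> \<alpha> / 2"
    using assms by (auto simp: \<beta>_def max_def field_simps)
  have "(\<alpha> - \<beta>) * ln 2 \<le> \<alpha> - \<beta>"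
    using \<beta> ln_2_less_1 by (intro mult_left_le) auto
  also note \<beta>(3)
  finally have "(\<alpha> - \<beta>) * ln 2 \<le> F \<rho> \<alpha> / 2" .
  then have "0 < F \<rho> \<beta>"
    using F_lipschitz[OF \<beta>(1) less_imp_le[OF \<beta>(2)]] assms(2) by linarith
  then show ?thesis
    using alpha_star_le[of \<beta>] \<beta> by simp
qed

lemma F_zero_below:
  assumes "0 \<le> \<alpha>" "\<alpha> \<le> alpha_star \<rho>"
  shows "F \<rho> \<alpha> = 0"
  using alpha_star_less[of \<alpha>] F_nonneg[of \<alpha>] F_zero assms by (cases "\<alpha> = 0") force+

section \<open>Local behaviour at the endpoints of [0, 1]\<close>

text \<open>Replaces \<rho> by an explicit minorant r, so that positivity near 0 can be read off an
  asymptotic expansion; a single x in (0, 1) then suffices.\<close>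

lemma F_pos_if_obj_pos:
  assumes "0 \<le> \<alpha>" "\<forall>\<^sub>F x in at_right 0. 0 < \<alpha> * ln (1 + r x) - D x"
    and "\<And>x. 0 \<le> x \<Longrightarrow> x \<le> 1 \<Longrightarrow> 0 \<le> r x \<and> r x \<le> \<rho> x"
  shows "0 < F \<rho> \<alpha>"
proof -
  have "\<forall>\<^sub>F x in at_right 0. x \<in> {0<..<1::real}"
    by (rule eventually_at_right_real) simp
  with assms(2) have "\<forall>\<^sub>F x in at_right 0. 0 < \<alpha> * ln (1 + r x) - D x \<and> x \<in> {0<..<1}"
    by (rule eventually_conj)
  then obtain x where x: "0 < \<alpha> * ln (1 + r x) - D x" "0 < x" "x < 1"
    using eventually_happens[of _ "at_right (0::real)"] by auto
  have "\<alpha> * ln (1 + r x) \<le> \<alpha> * ln (1 + \<rho> x)"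
    using assms(1) assms(3)[of x] x by (intro mult_left_mono ln_mono) auto
  then show ?thesis
    using F_ge[of \<alpha> x] assms(1) x by (simp add: obj_def)
qed

text \<open>Near 0 the gain is of order \<alpha> p x, while the entropy cost is only of order
  x^2.\<close>

lemma alpha_star_eq_0_if_linear:
  assumes "0 < p" "\<And>x. 0 \<le> x \<Longrightarrow> x \<le> 1 \<Longrightarrow> p * x \<le> \<rho> x"
  shows "alpha_star \<rho> = 0"
proof (rule antisym[OF alpha_star_le_if_pos_above alpha_star_nonneg])
  fix \<alpha> :: real assume "0 < \<alpha>"
  have "\<forall>\<^sub>F x in at_right 0. 0 < \<alpha> * ln (1 + p * x) - D x"
    unfolding D_def using \<open>0 < \<alpha>\<close> assms(1) by real_asymp
  then show "0 < F \<rho> \<alpha>"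
    using assms \<open>0 < \<alpha>\<close> by (intro F_pos_if_obj_pos[where r = "\<lambda>x. p * x"]) auto
qed simp

lemma alpha_star_le_half_if_square:
  assumes "\<And>x. 0 \<le> x \<Longrightarrow> x \<le> 1 \<Longrightarrow> x\<^sup>2 \<le> \<rho> x"
  shows "alpha_star \<rho> \<le> 1 / 2"
proof (rule alpha_star_le_if_pos_above)
  fix \<alpha> :: real assume "1 / 2 < \<alpha>"
  then have "\<alpha> - 1 / 2 > 0" by simp
  \<comment> \<open>Gain and cost are both quadratic here; dividing by x^2 leaves the difference of
    their leading coefficients.\<close>
  have "((\<lambda>x. (\<alpha> * ln (1 + x\<^sup>2) - D x) / x\<^sup>2) \<longlongrightarrow> \<alpha> - 1 / 2) (at_right 0)"
    unfolding D_def by real_asymp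
  then have "\<forall>\<^sub>F x in at_right 0. 0 < (\<alpha> * ln (1 + x\<^sup>2) - D x) / x\<^sup>2"
    using \<open>\<alpha> - 1 / 2 > 0\<close> by (rule order_tendstoD)
  then have "\<forall>\<^sub>F x in at_right 0. 0 < \<alpha> * ln (1 + x\<^sup>2) - D x"
    by eventually_elim (auto simp: zero_less_divide_iff not_less[symmetric])
  then show "0 < F \<rho> \<alpha>"
    using assms \<open>1 / 2 < \<alpha>\<close> by (intro F_pos_if_obj_pos[where r = "\<lambda>x. x\<^sup>2"]) auto
qed simp

text \<open>The chain ln (1 + \<rho> x) <= \<rho> x <= x^2 <= 2 D x makes the objective at \<alpha>
  = 1/2 nonpositive on all of [0, 1].\<close>

lemma alpha_star_ge_half_if_le_square:
  assumes "\<And>x. 0 \<le> x \<Longrightarrow> x \<le> 1 \<Longrightarrow> \<rho> x \<le> x\<^sup>2"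
  shows "1 / 2 \<le> alpha_star \<rho>"
proof -
  have "F \<rho> (1 / 2) \<le> 0"
  proof (rule F_le)
    fix x :: real assume x: "0 \<le> x" "x \<le> 1"
    have "ln (1 + \<rho> x) \<le> \<rho> x"
      using nonneg[OF x] by (rule ln_add_one_self_le_self)
    then show "obj (1 / 2) x \<le> 0"
      unfolding obj_def using assms[OF x] D_ge_half_square[OF x] by linarith
  qed simp
  then show ?thesis
    using F_pos_above[of "1 / 2"] by force
qed

text \<open>Take \<alpha> = 1 and x = 1 - t. Then ln (2 - m t) = ln 2 + O(t), whereas D (1 - t) = ln
  2 + (t / 2) ln t + O(t), so for small t the term -(t / 2) ln t dominates and the objective is
  positive.\<close>

lemma alpha_star_less_1_if_finite_slope:
  assumes "\<And>x. 0 \<le> x \<Longrightarrow> x \<le> 1 \<Longrightarrow> 1 - m * (1 - x) \<le> \<rho> x"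
  shows "alpha_star \<rho> < 1"
proof (rule alpha_star_less)
  have "\<forall>\<^sub>F t in at_right 0. 0 < ln (2 - m * t) - D (1 - t)"
    unfolding D_def by real_asymp
  moreover have "\<forall>\<^sub>F t in at_right 0. 0 < 2 - m * t"
    by real_asymp
  moreover have "\<forall>\<^sub>F t in at_right 0. t \<in> {0<..<1::real}"
    by (rule eventually_at_right_real) simp
  ultimately have "\<forall>\<^sub>F t in at_right 0. 0 < ln (2 - m * t) - D (1 - t) \<and> 0 < 2 - m * t \<and> t \<in> {0<..<1}"
    by eventually_elim auto
  then obtain t where t: "0 < ln (2 - m * t) - D (1 - t)" "0 < 2 - m * t" "0 < t" "t < 1"
    using eventually_happens[of _ "at_right (0::real)"] by auto
  have "ln (2 - m * t) \<le> ln (1 + \<rho> (1 - t))"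
    using t assms[of "1 - t"] by (intro ln_mono) auto
  then show "0 < F \<rho> 1"
    using F_ge[of 1 "1 - t"] t by (simp add: obj_def)
qed simp

end

text \<open>A smaller map has a smaller \<open>F\<close>, hence a smaller set of \<alpha> with
  positive value, hence a larger infimum.\<close>

lemma alpha_star_antimono:
  assumes "unit_interval_map \<sigma>" "unit_interval_map \<rho>"
    and "\<And>x. 0 \<le> x \<Longrightarrow> x \<le> 1 \<Longrightarrow> \<sigma> x \<le> \<rho> x"
  shows "alpha_star \<rho> \<le> alpha_star \<sigma>"
proof -
  interpret s: unit_interval_map \<sigma> by fact
  interpret r: unit_interval_map \<rho> by fact
  have "F \<sigma> \<alpha> \<le> F \<rho> \<alpha>" if "0 \<le> \<alpha>" for \<alpha>
  proof (rule s.F_le[OF that])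
    fix x :: real assume x: "0 \<le> x" "x \<le> 1"
    have "\<alpha> * ln (1 + \<sigma> x) \<le> \<alpha> * ln (1 + \<rho> x)"
      using that assms(3)[OF x] s.nonneg[OF x] by (intro mult_left_mono ln_mono) auto
    then show "s.obj \<alpha> x \<le> F \<rho> \<alpha>"
      using r.F_ge[OF that x] by (simp add: s.obj_def r.obj_def)
  qed
  then show ?thesis
    by (intro s.alpha_star_ge r.alpha_star_le) (auto intro: less_le_trans)
qed

section \<open>Bounds on probability generating functions\<close>

text \<open>Measurability into \<open>count_space {1..}\<close> also encodes that W is at least 1 on
  the whole space.\<close>

locale positive_nat_variable = prob_space M for M :: "'a measure" +
  fixes W :: "'a \<Rightarrow> nat"
  assumes measurable_W: "W \<in> measurable M (count_space {1..})"
begin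

lemma random_variable_W [measurable]: "W \<in> measurable M (count_space UNIV)"
  using measurable_compose[OF measurable_W, of "\<lambda>n. n"] by simp

lemma W_pos: "\<omega> \<in> space M \<Longrightarrow> 1 \<le> W \<omega>"
  using measurable_space[OF measurable_W] by auto

lemma integrable_bounded_of_W:
  fixes f :: "nat \<Rightarrow> real"
  assumes "\<And>n. \<bar>f n\<bar> \<le> B"
  shows "integrable M (\<lambda>\<omega>. f (W \<omega>))"
  by (rule integrable_const_bound[of _ B]) (auto simp: assms)

lemma integrable_power:
  fixes s :: real
  assumes "0 \<le> s" "s \<le> 1"
  shows "integrable M (\<lambda>\<omega>. s ^ W \<omega>)"
  by (rule integrable_bounded_of_W[of _ 1]) (use assms in \<open>auto simp: power_le_one\<close>)

sublocale unit_interval_map "pgf M W"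
proof
  have "(\<integral>\<omega>. 0 ^ W \<omega> \<partial>M) = (\<integral>\<omega>. (0::real) \<partial>M)"
    by (intro Bochner_Integration.integral_cong refl) (use W_pos in force)
  then show "pgf M W 0 = 0"
    by (simp add: pgf_def)
  show "pgf M W 1 = 1"
    by (simp add: pgf_def prob_space)
  fix x :: real assume x: "0 \<le> x" "x \<le> 1"
  then show "0 \<le> pgf M W x"
    by (simp add: pgf_def)
  have "(\<integral>\<omega>. x ^ W \<omega> \<partial>M) \<le> (\<integral>\<omega>. 1 \<partial>M)"
    using x by (intro integral_mono integrable_power) (auto simp: power_le_one)
  then show "pgf M W x \<le> 1"
    by (simp add: pgf_def prob_space)
qed

text \<open>Only the contribution of the event W = 1 to the expectation is kept.\<close>

lemma pgf_ge_linear: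
  assumes "0 \<le> s" "s \<le> 1"
  shows "\<P>(\<omega> in M. W \<omega> = 1) * s \<le> pgf M W s"
proof -
  have "\<P>(\<omega> in M. W \<omega> = 1) * s = (\<integral>\<omega>. indicator {1} (W \<omega>) * s \<partial>M)"
  proof -
    have "\<P>(\<omega> in M. W \<omega> = 1) = (\<integral>\<omega>. indicator {\<omega> \<in> space M. W \<omega> = 1} \<omega> \<partial>M)"
      by simp
    also have "\<dots> = (\<integral>\<omega>. indicator {1} (W \<omega>) \<partial>M)"
      by (intro Bochner_Integration.integral_cong) (auto simp: indicator_def)
    finally show ?thesis by simp
  qed
  also have "\<dots> \<le> pgf M W s"
    unfolding pgf_def
    by (rule integral_mono[OF integrable_bounded_of_W[where B = 1] integrable_power])
      (use assms in \<open>auto simp: indicator_def\<close>)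
  finally show ?thesis .
qed

lemma pgf_le_square:
  assumes "AE \<omega> in M. 2 \<le> W \<omega>" "0 \<le> s" "s \<le> 1"
  shows "pgf M W s \<le> s\<^sup>2"
proof -
  have "(\<integral>\<omega>. s ^ W \<omega> \<partial>M) \<le> (\<integral>\<omega>. s\<^sup>2 \<partial>M)"
  proof (rule integral_mono_AE[OF integrable_power])
    show "AE \<omega> in M. s ^ W \<omega> \<le> s\<^sup>2"
      using assms(1) by eventually_elim (use assms in \<open>simp add: power_decreasing\<close>)
  qed (use assms in auto)
  then show ?thesis
    by (simp add: pgf_def prob_space)
qed

lemma pgf_eq_square:
  assumes "AE \<omega> in M. W \<omega> = 2"
  shows "pgf M W s = s\<^sup>2"
proof -
  have "(\<integral>\<omega>. s ^ W \<omega> \<partial>M) = (\<integral>\<omega>. s\<^sup>2 \<partial>M)"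
    by (rule integral_cong_AE) (use assms in auto)
  then show ?thesis
    by (simp add: pgf_def prob_space)
qed

text \<open>Bernoulli's inequality bounds each power from below by its tangent at 1; taking
  expectations turns the slope into the mean.\<close>

lemma pgf_ge_affine:
  assumes "integrable M (\<lambda>\<omega>. real (W \<omega>))" "0 \<le> s" "s \<le> 1"
  shows "1 - expectation (\<lambda>\<omega>. real (W \<omega>)) * (1 - s) \<le> pgf M W s"
proof -
  have "1 - expectation (\<lambda>\<omega>. real (W \<omega>)) * (1 - s) = (\<integral>\<omega>. 1 - real (W \<omega>) * (1 - s) \<partial>M)"
    using assms(1) by (simp add: prob_space)
  also have "\<dots> \<le> pgf M W s"
    unfolding pgf_def
  proof (rule integral_mono)
    fix \<omega>
    show "1 - real (W \<omega>) * (1 - s) \<le> s ^ W \<omega>"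
      using Bernoulli_inequality[of "s - 1" "W \<omega>"] assms by (simp add: algebra_simps)
  qed (use assms integrable_power in auto)
  finally show ?thesis .
qed

lemma alpha_star_pgf_less_1:
  assumes "integrable M (\<lambda>\<omega>. real (W \<omega>))"
  shows "alpha_star (pgf M W) < 1"
  using pgf_ge_affine[OF assms] by (rule alpha_star_less_1_if_finite_slope)

lemma alpha_star_pgf_ge_half:
  assumes "AE \<omega> in M. 2 \<le> W \<omega>"
  shows "1 / 2 \<le> alpha_star (pgf M W)"
  using pgf_le_square[OF assms] by (rule alpha_star_ge_half_if_le_square)

lemma alpha_star_pgf_eq_0_iff: "alpha_star (pgf M W) = 0 \<longleftrightarrow> 0 < \<P>(\<omega> in M. W \<omega> = 1)"
proof
  assume "0 < \<P>(\<omega> in M. W \<omega> = 1)"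
  then show "alpha_star (pgf M W) = 0"
    using pgf_ge_linear by (rule alpha_star_eq_0_if_linear)
next
  assume zero: "alpha_star (pgf M W) = 0"
  show "0 < \<P>(\<omega> in M. W \<omega> = 1)"
  proof (rule ccontr)
    assume "\<not> 0 < \<P>(\<omega> in M. W \<omega> = 1)"
    then have "\<P>(\<omega> in M. W \<omega> = 1) = 0"
      by (simp add: zero_less_measure_iff)
    then have "AE \<omega> in M. W \<omega> \<noteq> 1"
      by (subst (asm) prob_eq_0) auto
    \<comment> \<open>Excluding the value 1 leaves W >= 2 almost surely, which would force a
      threshold of at least 1/2.\<close>
    then have "AE \<omega> in M. 2 \<le> W \<omega>"
      using AE_space by eventually_elim (use W_pos in force)
    then show False
      using alpha_star_pgf_ge_half zero by fastforce
  qed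
qed

section \<open>Stochastic dominance by summation by parts\<close>

text \<open>Writes the truncated generating function in terms of the tails of W, the quantities that
  stochastic dominance compares.\<close>

lemma integral_power_min:
  fixes s :: real
  shows "(\<integral>\<omega>. s ^ min (W \<omega>) K \<partial>M) = 1 - (1 - s) * (\<Sum>k<K. s ^ k * \<P>(\<omega> in M. W \<omega> \<ge> Suc k))"
proof -
  let ?I = "\<lambda>k. {\<omega> \<in> space M. W \<omega> \<ge> Suc k}"
  \<comment> \<open>This is the finite geometric sum 1 - s^j = (1 - s) (1 + s + ... + s^(j - 1)) for
    j = min n K, with the cut at n expressed by an indicator.\<close>
  have pw: "s ^ min n K = 1 - (1 - s) * (\<Sum>k<K. s ^ k * of_bool (Suc k \<le> n))" for n
  proof (induction K)
    case (Suc K)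
    show ?case
    proof (cases "Suc K \<le> n")
      case True
      then have "min n K = K" "min n (Suc K) = Suc K" by auto
      moreover have "(1 - s) * (S + s ^ K) = (1 - s) * S + s ^ K - s * s ^ K" for S
        by (simp add: algebra_simps)
      ultimately show ?thesis using Suc True by simp
    next
      case False
      then have "min n K = n" "min n (Suc K) = n" by auto
      then show ?thesis using Suc False by simp
    qed
  qed simp
  have "(\<integral>\<omega>. s ^ min (W \<omega>) K \<partial>M) =
      (\<integral>\<omega>. 1 - (1 - s) * (\<Sum>k<K. s ^ k * indicator (?I k) \<omega>) \<partial>M)"
    by (intro Bochner_Integration.integral_cong refl)
      (auto simp: pw indicator_def of_bool_def intro!: sum.cong)
  also have "\<dots> = 1 - (1 - s) * (\<Sum>k<K. \<integral>\<omega>. s ^ k * indicator (?I k) \<omega> \<partial>M)"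
    by (simp add: prob_space Bochner_Integration.integral_sum less_top[symmetric] del: sum_mult_indicator)
  also have "\<dots> = 1 - (1 - s) * (\<Sum>k<K. s ^ k * prob (?I k))"
    by simp
  finally show ?thesis .
qed

lemma integrable_power_min:
  fixes s :: real
  assumes "0 \<le> s" "s \<le> 1"
  shows "integrable M (\<lambda>\<omega>. s ^ min (W \<omega>) K)"
  by (rule integrable_bounded_of_W[of _ 1]) (use assms in \<open>auto simp: power_le_one\<close>)

lemma pgf_le_truncated:
  assumes "0 \<le> s" "s \<le> 1"
  shows "pgf M W s \<le> (\<integral>\<omega>. s ^ min (W \<omega>) K \<partial>M)"
  unfolding pgf_def using assms
  by (intro integral_mono integrable_power integrable_power_min) (auto intro: power_decreasing)

text \<open>The truncated power is one of \<open>s ^ W \<omega>\<close> and \<open>s ^ K\<close>,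
  and both are nonnegative.\<close>

lemma truncated_le_pgf:
  assumes "0 \<le> s" "s \<le> 1"
  shows "(\<integral>\<omega>. s ^ min (W \<omega>) K \<partial>M) \<le> pgf M W s + s ^ K"
proof -
  have "(\<integral>\<omega>. s ^ min (W \<omega>) K \<partial>M) \<le> (\<integral>\<omega>. s ^ W \<omega> + s ^ K \<partial>M)"
    using assms by (intro integral_mono integrable_power_min Bochner_Integration.integrable_add
        integrable_power) (auto simp: min_def)
  also have "\<dots> = pgf M W s + s ^ K"
    using assms by (simp add: pgf_def integrable_power prob_space)
  finally show ?thesis .
qed

end

text \<open>The exponents are truncated at \<open>K\<close> so that summation by parts stays finite;
  the error \<open>s ^ K\<close> vanishes as \<open>K\<close> grows.\<close>

lemma pgf_le_if_stoch_dominates: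
  assumes "positive_nat_variable M W" "positive_nat_variable N V"
    and "stoch_dominates N V M W" "0 \<le> s" "s \<le> 1"
  shows "pgf N V s \<le> pgf M W s"
\<comment> \<open>At s = 1 the error \<open>s ^ K\<close> does not vanish, but both generating
  functions equal 1.\<close>
proof (cases "s = 1")
  case True
  interpret W: positive_nat_variable M W by fact
  interpret V: positive_nat_variable N V by fact
  show ?thesis
    by (simp add: True W.at_1 V.at_1)
next
  case False
  interpret W: positive_nat_variable M W by fact
  interpret V: positive_nat_variable N V by fact
  have "pgf N V s \<le> pgf M W s + s ^ K" for K
  proof -
    have "pgf N V s \<le> 1 - (1 - s) * (\<Sum>k<K. s ^ k * \<P>(\<omega> in N. V \<omega> \<ge> Suc k))"
      using V.pgf_le_truncated[of s K] assms by (simp add: V.integral_power_min)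
    \<comment> \<open>The tails enter with a nonpositive factor, so the larger tails of V give the
      smaller value.\<close>
    also have "\<dots> \<le> 1 - (1 - s) * (\<Sum>k<K. s ^ k * \<P>(\<omega> in M. W \<omega> \<ge> Suc k))"
      using assms unfolding stoch_dominates_def
      by (intro diff_left_mono mult_left_mono sum_mono) auto
    also have "\<dots> \<le> pgf M W s + s ^ K"
      using W.truncated_le_pgf[of s K] assms by (simp add: W.integral_power_min)
    finally show ?thesis .
  qed
  moreover have "(\<lambda>K. pgf M W s + s ^ K) \<longlonglongrightarrow> pgf M W s + 0"
    using assms False by (intro tendsto_intros LIMSEQ_power_zero) auto
  ultimately show ?thesis
    by (intro LIMSEQ_le_const[where a = "pgf N V s"]) auto
qed

theorem proposition2p1:
  fixes M :: "'a measure" and W :: "'a \<Rightarrow> nat" and \<rho> :: "real \<Rightarrow> real"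
  assumes "prob_space M"
    and "W \<in> measurable M (count_space {1..})"
    and "\<rho> = pgf M W"
  shows "(\<forall>\<alpha>. 0 \<le> \<alpha> \<and> \<alpha> \<le> alpha_star \<rho> \<longrightarrow> F \<rho> \<alpha> = 0)
    \<and> (\<forall>\<alpha>. \<alpha> > alpha_star \<rho> \<longrightarrow> F \<rho> \<alpha> > 0)
    \<and> continuous_on {0..} (F \<rho>) \<and> mono_on {0..} (F \<rho>)
    \<and> alpha_star \<rho> \<in> {0..1}
    \<and> (integrable M (\<lambda>\<omega>. real (W \<omega>)) \<longrightarrow> alpha_star \<rho> < 1)
    \<and> (alpha_star \<rho> = 0 \<longleftrightarrow> \<P>(\<omega> in M. W \<omega> = 1) > 0)
    \<and> (\<P>(\<omega> in M. W \<omega> = 2) = 1 \<longrightarrow> alpha_star \<rho> = 1 / 2)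
    \<and> (\<forall>(N :: 'b measure) V. prob_space N \<and> V \<in> measurable N (count_space {1..}) \<longrightarrow>
         ((\<forall>s\<in>{0..1}. pgf N V s \<le> \<rho> s) \<longrightarrow> alpha_star (pgf N V) \<ge> alpha_star \<rho>)
         \<and> (stoch_dominates N V M W \<longrightarrow> (\<forall>s\<in>{0..1}. pgf N V s \<le> \<rho> s)))
    \<and> (\<P>(\<omega> in M. W \<omega> \<ge> 2) = 1 \<and> integrable M (\<lambda>\<omega>. real (W \<omega>)) \<longrightarrow>
         alpha_star \<rho> \<in> {1/2..<1})"
proof -
  interpret prob_space M by fact
  interpret W: positive_nat_variable M W
    by unfold_locales fact
  have AE_2: "AE \<omega> in M. W \<omega> = 2" if "\<P>(\<omega> in M. W \<omega> = 2) = 1"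
    using that by (subst (asm) prob_Collect_eq_1) auto
  have AE_ge_2: "AE \<omega> in M. 2 \<le> W \<omega>" if "\<P>(\<omega> in M. W \<omega> \<ge> 2) = 1"
    using that by (subst (asm) prob_Collect_eq_1) auto
  have half: "alpha_star (pgf M W) = 1 / 2" if "\<P>(\<omega> in M. W \<omega> = 2) = 1"
    using W.pgf_eq_square[OF AE_2[OF that]]
    by (intro antisym W.alpha_star_le_half_if_square W.alpha_star_ge_half_if_le_square) auto
  have comparison: "((\<forall>s\<in>{0..1}. pgf N V s \<le> pgf M W s) \<longrightarrow> alpha_star (pgf N V) \<ge> alpha_star (pgf M W))
      \<and> (stoch_dominates N V M W \<longrightarrow> (\<forall>s\<in>{0..1}. pgf N V s \<le> pgf M W s))"
    if "prob_space N \<and> V \<in> measurable N (count_space {1..})" for N :: "'b measure" and V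
  proof -
    interpret V: positive_nat_variable N V
      using that by (auto simp: positive_nat_variable_def positive_nat_variable_axioms_def)
    show ?thesis
      using alpha_star_antimono[OF V.unit_interval_map_axioms W.unit_interval_map_axioms]
        pgf_le_if_stoch_dominates[OF W.positive_nat_variable_axioms V.positive_nat_variable_axioms]
      by auto
  qed
  show ?thesis
    unfolding assms(3)
    using W.F_zero_below W.F_pos_above W.continuous_on_F W.F_mono W.alpha_star_nonneg
      W.alpha_star_le_1 W.alpha_star_pgf_less_1 W.alpha_star_pgf_eq_0_iff half comparison
      W.alpha_star_pgf_ge_half[OF AE_ge_2]
    by (intro conjI) (auto simp: mono_on_def)
qed

end
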